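(* Let $h\in\mathbb{R}$ and $\tau(h)=h^2+3h+9$. The zeros of the Shanks cubic polynomial $\rho(h,-1,x)=x^3-hx^2-(h+3)x-1$ are $$\frac{1}{3}\left(h+2\sqrt{\tau(h)}\,\cos\left(\frac{1}{3}\left(\arctan\left(\frac{3\sqrt{3}}{3+2h}\right)+k\pi\right)\right)\right),\quad k=0,2,4,\qquad\text{if } h\geq-\frac{3}{2},$$ $$\frac{1}{3}\left(h-2\sqrt{\tau(h)}\,\cos\left(\frac{1}{3}\left(\arctan\left(\frac{3\sqrt{3}}{3+2h}\right)+k\pi\right)\right)\right),\quad k=0,2,4,\qquad\text{if } h\leq-\frac{3}{2}.$$ In particular, if $h=-\frac{3}{2}$, then, reading the arctangent as $\arctan(+\infty)=\frac{\pi}{2}$ in the first formula and as $\arctan(-\infty)=-\frac{\pi}{2}$ in the second formula, each formula gives the zeros $1,-\frac{1}{2},-2$ of $\rho(-\frac32,-1,x)$.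
   Context: For $h,s\in\mathbb{R}$, $\rho(h,s,x)=x^3+hsx^2-(h+3)s^2x+s^3$. The Shanks cubic polynomials are the polynomials $\rho(h,-1,x)$. The function $\arctan$ takes values in $(-\frac{\pi}{2},\frac{\pi}{2})$, with the stated limiting convention at $h=-\frac32$. *)

theory Defs
  imports "HOL-Analysis.Analysis" "HOL-Computational_Algebra.Polynomial"
begin

definition \<rho> :: "real \<Rightarrow> real \<Rightarrow> real poly" where
  "\<rho> h s = [:s ^ 3, - ((h + 3) * s\<^sup>2), h * s, 1:]"

lemma poly_\<rho>: "poly (\<rho> h s) x = x ^ 3 + h * s * x\<^sup>2 - (h + 3) * s\<^sup>2 * x + s ^ 3"
  by (simp add: \<rho>_def algebra_simps power2_eq_square power3_eq_cube)

definition \<tau> :: "real \<Rightarrow> real" where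
  "\<tau> h = h\<^sup>2 + 3 * h + 9"

text \<open>
  The quantity \<open>arctan (3 * sqrt 3 / (3 + 2 * h))\<close>, extended to \<open>h = -3/2\<close> by its limit from the
  right (argument \<open>+\<infinity>\<close>), respectively from the left (argument \<open>-\<infinity>\<close>). The case distinction is needed
  because division by zero yields \<open>0\<close> in HOL.
\<close>

definition arctan_ge :: "real \<Rightarrow> real" where
  "arctan_ge h = (if h = -3/2 then pi / 2 else arctan (3 * sqrt 3 / (3 + 2 * h)))"

definition arctan_le :: "real \<Rightarrow> real" where
  "arctan_le h = (if h = -3/2 then - (pi / 2) else arctan (3 * sqrt 3 / (3 + 2 * h)))"

lemma arctan_ge_limit:
  "((\<lambda>h. arctan (3 * sqrt 3 / (3 + 2 * h))) \<longlongrightarrow> arctan_ge (-3/2)) (at_right (-3/2))"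
proof -
  have "filterlim (\<lambda>h::real. 3 * sqrt 3 / (3 + 2 * h)) at_top (at_right (-3/2))"
  proof (rule LIM_at_top_divide)
    show "((\<lambda>h::real. 3 * sqrt 3) \<longlongrightarrow> 3 * sqrt 3) (at_right (-3/2))" by simp
    show "((\<lambda>h::real. 3 + 2 * h) \<longlongrightarrow> 0) (at_right (-3/2))"
      by (auto intro!: tendsto_eq_intros)
    show "\<forall>\<^sub>F h::real in at_right (-3/2). 0 < 3 + 2 * h"
      by (rule eventually_at_rightI[of _ 0]) auto
  qed simp
  from filterlim_compose[OF tendsto_arctan_at_top this] show ?thesis
    by (simp add: arctan_ge_def)
qed

lemma arctan_le_limit:
  "((\<lambda>h. arctan (3 * sqrt 3 / (3 + 2 * h))) \<longlongrightarrow> arctan_le (-3/2)) (at_left (-3/2))"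
proof -
  have "filterlim (\<lambda>h::real. 3 * sqrt 3 / (- (3 + 2 * h))) at_top (at_left (-3/2))"
  proof (rule LIM_at_top_divide)
    show "((\<lambda>h::real. 3 * sqrt 3) \<longlongrightarrow> 3 * sqrt 3) (at_left (-3/2))" by simp
    show "((\<lambda>h::real. - (3 + 2 * h)) \<longlongrightarrow> 0) (at_left (-3/2))"
      by (auto intro!: tendsto_eq_intros)
    show "\<forall>\<^sub>F h::real in at_left (-3/2). 0 < - (3 + 2 * h)"
      by (rule eventually_at_leftI[of "-2"]) auto
  qed simp
  hence "filterlim (\<lambda>h::real. 3 * sqrt 3 / (3 + 2 * h)) at_bot (at_left (-3/2))"
    unfolding filterlim_uminus_at_bot by (simp only: minus_divide_right)
  from filterlim_compose[OF tendsto_arctan_at_bot this] show ?thesis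
    by (simp add: arctan_le_def)
qed

end

theory Submission
  imports Defs
begin

text \<open>
  Substituting \<open>x = (h + 2 r c) / 3\<close> with \<open>r\<^sup>2 = \<tau> h\<close> into \<open>\<rho> h (-1)\<close> gives
  \<open>27 \<rho> = 2 r \<tau> h (4 c\<^sup>3 - 3 c) - (2 h + 3) \<tau> h\<close>, so by the triple angle formula Viete's trigonometric
  solution applies to every \<open>t\<close> with \<open>2 r cos t = 2 h + 3\<close>. Since \<open>4 \<tau> h = (2 h + 3)\<^sup>2 + 27\<close>, the
  arctangent in the formula is such a \<open>t\<close>, with \<open>r\<close> of the same sign as \<open>2 h + 3\<close>.
\<close>

lemma proots_cubic_linear_factors:
  fixes a b c :: "'a :: idom"
  shows "proots ([:- a, 1:] * [:- b, 1:] * [:- c, 1:]) = {#a, b, c#}"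
  \<comment> \<open>The deleted rules would expand the product before \<open>proots_mult\<close> can
    split it.\<close>
  by (simp add: proots_mult del: mult_pCons_left mult_pCons_right)

text \<open>These are the shifts of \<open>t / 3\<close> in \<open>1/3 * (t + k * pi)\<close> for
  \<open>k = 2\<close> and \<open>k = 4\<close>.\<close>

lemma cos_add_2pi_thirds: "cos (x + 2 * pi / 3) = - cos x / 2 - sqrt 3 / 2 * sin x"
  and cos_add_4pi_thirds: "cos (x + 4 * pi / 3) = - cos x / 2 + sqrt 3 / 2 * sin x"
proof -
  have "cos (2 * pi / 3) = - 1 / 2" "sin (2 * pi / 3) = sqrt 3 / 2"
    using cos_120 sin_120 by simp_all
  moreover have "cos (4 * pi / 3) = - 1 / 2" "sin (4 * pi / 3) = - sqrt 3 / 2"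
  proof -
    have "4 * pi / 3 = pi / 3 + pi"
      by simp
    then show "cos (4 * pi / 3) = - 1 / 2" "sin (4 * pi / 3) = - sqrt 3 / 2"
      by (simp_all only: cos_periodic_pi sin_periodic_pi cos_60 sin_60)
  qed
  ultimately show "cos (x + 2 * pi / 3) = - cos x / 2 - sqrt 3 / 2 * sin x"
    "cos (x + 4 * pi / 3) = - cos x / 2 + sqrt 3 / 2 * sin x"
    by (simp_all add: cos_add)
qed

text \<open>Comparing elementary symmetric functions of the three values with the coefficients
  yields a full factorization, hence multiplicities as well, with no distinctness argument. The sign
  of \<open>r\<close> is left open so that both \<open>sqrt (\<tau> h)\<close> and its negative
  fit.\<close>

lemma proots_shanks_cubic:
  fixes h r t :: real
  assumes r: "r\<^sup>2 = \<tau> h" and t: "2 * r * cos t = 2 * h + 3"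
  shows "proots (\<rho> h (-1)) =
    image_mset (\<lambda>k. 1/3 * (h + 2 * r * cos (1/3 * (t + k * pi)))) {#0, 2, 4#}"
proof -
  define c where "c k = cos (1/3 * (t + k * pi))" for k
  define s where "s = sin (t / 3)"
  have c2: "c 2 = - c 0 / 2 - sqrt 3 / 2 * s" and c4: "c 4 = - c 0 / 2 + sqrt 3 / 2 * s"
    using cos_add_2pi_thirds[of "t / 3"] cos_add_4pi_thirds[of "t / 3"]
    by (simp_all add: c_def s_def algebra_simps)
  have s2: "s\<^sup>2 = 1 - (c 0)\<^sup>2"
    by (simp add: c_def s_def sin_squared_eq)
  have cos_t: "cos t = 4 * c 0 ^ 3 - 3 * c 0"
    using cos_treble_cos[of "t / 3"] by (simp add: c_def)
  \<comment> \<open>\<open>e1\<close>, \<open>e2\<close> and \<open>e3\<close> identify the three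
    cosines as the roots of \<open>4 * X ^ 3 - 3 * X - cos t\<close>.\<close>
  have e1: "c 0 + c 2 + c 4 = 0"
    by (simp add: c2 c4)
  have c24: "c 2 * c 4 = (c 0)\<^sup>2 - 3 / 4"
  proof -
    have "c 2 * c 4 = (c 0)\<^sup>2 / 4 - (sqrt 3)\<^sup>2 / 4 * s\<^sup>2"
      by (simp only: c2 c4) (simp add: algebra_simps power2_eq_square)
    then show ?thesis by (simp add: s2 field_simps)
  qed
  have c24_sum: "c 2 + c 4 = - c 0"
    using e1 by simp
  have e2: "c 0 * c 2 + c 0 * c 4 + c 2 * c 4 = - 3 / 4"
    using c24 by (simp add: c24_sum power2_eq_square flip: distrib_left)
  have e3: "4 * (c 0 * c 2 * c 4) = cos t"
    by (simp add: cos_t c24 mult.assoc) (simp add: algebra_simps power2_eq_square power3_eq_cube)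
  define x where "x k = 1/3 * (h + 2 * r * c k)" for k
  have v1: "x 0 + x 2 + x 4 = h"
  proof -
    have "x 0 + x 2 + x 4 = h + 2/3 * r * (c 0 + c 2 + c 4)"
      by (simp add: x_def field_simps)
    then show ?thesis by (simp add: e1)
  qed
  have v2: "x 0 * x 2 + x 0 * x 4 + x 2 * x 4 = - (h + 3)"
  proof -
    have "9 * (x 0 * x 2 + x 0 * x 4 + x 2 * x 4) = 3 * h\<^sup>2 + 4 * h * r * (c 0 + c 2 + c 4)
        + 4 * r\<^sup>2 * (c 0 * c 2 + c 0 * c 4 + c 2 * c 4)"
      by (simp add: x_def field_simps power2_eq_square)
    then show ?thesis by (simp only: e1 e2 r \<tau>_def) (simp add: field_simps)
  qed
  have v3: "x 0 * x 2 * x 4 = 1"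
  proof -
    \<comment> \<open>The last summand is grouped so that \<open>e3\<close> produces
      \<open>2 * r * cos t\<close>, which \<open>t\<close> then rewrites. What remains is
      \<open>h ^ 3 - (h - 3) * \<tau> h\<close>, and
      \<open>(h - 3) * \<tau> h = h ^ 3 - 27\<close>.\<close>
    have "27 * (x 0 * x 2 * x 4) = h ^ 3 + 2 * h\<^sup>2 * r * (c 0 + c 2 + c 4)
        + 4 * h * r\<^sup>2 * (c 0 * c 2 + c 0 * c 4 + c 2 * c 4) + r\<^sup>2 * (2 * r * (4 * (c 0 * c 2 * c 4)))"
      by (simp add: x_def field_simps power2_eq_square power3_eq_cube)
    also have "\<dots> = 27"
      by (simp only: e1 e2 e3 t r \<tau>_def) (simp add: field_simps power2_eq_square power3_eq_cube)
    finally show ?thesis by simp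
  qed
  have "\<rho> h (-1) = [:- x 0, 1:] * [:- x 2, 1:] * [:- x 4, 1:]"
    using v1 v2 v3 by (simp add: \<rho>_def algebra_simps)
  then show ?thesis
    by (simp only: proots_cubic_linear_factors) (simp add: x_def c_def)
qed

lemma tau_pos: "\<tau> h > 0"
proof -
  have "\<tau> h = (h + 3/2)\<^sup>2 + 27/4"
    by (simp add: \<tau>_def field_simps power2_eq_square)
  then show ?thesis
    by (simp add: add_nonneg_pos)
qed

text \<open>The arctangent has positive cosine \<open>1 / sqrt (1 + y\<^sup>2)\<close>, and
  \<open>(3 + 2 * h)\<^sup>2 + 27 = 4 * \<tau> h\<close>. The absolute value is what forces opposite
  signs of \<open>r\<close> on the two sides of \<open>-3/2\<close>.\<close>

lemma cos_arctan_shanks: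
  assumes "h \<noteq> -3/2"
  shows "2 * sqrt (\<tau> h) * cos (arctan (3 * sqrt 3 / (3 + 2 * h))) = \<bar>2 * h + 3\<bar>"
proof -
  have nz: "3 + 2 * h \<noteq> 0"
    using assms by auto
  have "1 + (3 * sqrt 3 / (3 + 2 * h))\<^sup>2 = 4 * \<tau> h / (3 + 2 * h)\<^sup>2"
    using nz by (simp add: \<tau>_def power_divide power_mult_distrib field_simps)
      (simp add: power2_eq_square algebra_simps)
  then have "sqrt (1 + (3 * sqrt 3 / (3 + 2 * h))\<^sup>2) = 2 * sqrt (\<tau> h) / \<bar>2 * h + 3\<bar>"
    by (simp add: real_sqrt_divide real_sqrt_mult add.commute)
  then show ?thesis
    using tau_pos[of h] by (simp add: cos_arctan)
qed

theorem theorem7: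
  fixes h :: real
  shows "(\<forall>x. poly (\<rho> h (-1)) x = x ^ 3 - h * x\<^sup>2 - (h + 3) * x - 1) \<and>
    (h \<ge> -3/2 \<longrightarrow>
      proots (\<rho> h (-1)) =
        image_mset (\<lambda>k. 1/3 * (h + 2 * sqrt (\<tau> h) * cos (1/3 * (arctan_ge h + k * pi)))) {#0, 2, 4#}) \<and>
    (h \<le> -3/2 \<longrightarrow>
      proots (\<rho> h (-1)) =
        image_mset (\<lambda>k. 1/3 * (h - 2 * sqrt (\<tau> h) * cos (1/3 * (arctan_le h + k * pi)))) {#0, 2, 4#}) \<and>
    (h = -3/2 \<longrightarrow>
      proots (\<rho> h (-1)) = {#1, -1/2, -2#} \<and>
      image_mset (\<lambda>k. 1/3 * (h + 2 * sqrt (\<tau> h) * cos (1/3 * (pi / 2 + k * pi)))) {#0, 2, 4#}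
        = {#1, -1/2, -2#} \<and>
      image_mset (\<lambda>k. 1/3 * (h - 2 * sqrt (\<tau> h) * cos (1/3 * (- (pi / 2) + k * pi)))) {#0, 2, 4#}
        = {#1, -1/2, -2#})"
proof -
  have sq: "(sqrt (\<tau> h))\<^sup>2 = \<tau> h" "(- sqrt (\<tau> h))\<^sup>2 = \<tau> h"
    using tau_pos[of h] by simp_all
  have ge: "proots (\<rho> h (-1)) =
      image_mset (\<lambda>k. 1/3 * (h + 2 * sqrt (\<tau> h) * cos (1/3 * (arctan_ge h + k * pi)))) {#0, 2, 4#}"
    if "h \<ge> -3/2"
  proof (rule proots_shanks_cubic[OF sq(1)])
    show "2 * sqrt (\<tau> h) * cos (arctan_ge h) = 2 * h + 3"
      \<comment> \<open>At \<open>h = -3/2\<close> both sides vanish, since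
        \<open>cos (pi / 2) = 0\<close>.\<close>
      using that cos_arctan_shanks[of h] by (cases "h = -3/2") (simp_all add: arctan_ge_def)
  qed
  have le: "proots (\<rho> h (-1)) =
      image_mset (\<lambda>k. 1/3 * (h - 2 * sqrt (\<tau> h) * cos (1/3 * (arctan_le h + k * pi)))) {#0, 2, 4#}"
    if "h \<le> -3/2"
  proof -
    have "2 * (- sqrt (\<tau> h)) * cos (arctan_le h) = 2 * h + 3"
      using that cos_arctan_shanks[of h] by (cases "h = -3/2") (simp_all add: arctan_le_def)
    from proots_shanks_cubic[OF sq(2) this] show ?thesis by simp
  qed
  have mid: "proots (\<rho> h (-1)) = {#1, -1/2, -2#}" if "h = -3/2"
  proof -
    have "\<rho> h (-1) = [:- 1, 1:] * [:- (-1/2), 1:] * [:- (-2), 1:]"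
      using that by (simp add: \<rho>_def)
    then show ?thesis
      by (simp only: proots_cubic_linear_factors)
  qed
  have "poly (\<rho> h (-1)) x = x ^ 3 - h * x\<^sup>2 - (h + 3) * x - 1" for x
    by (simp add: poly_\<rho>)
  \<comment> \<open>No cosine is evaluated: by \<open>ge\<close> and \<open>mid\<close> both
    multisets equal \<open>proots (\<rho> h (-1))\<close>. The second formula is treated likewise
    with \<open>le\<close>.\<close>
  moreover have "image_mset (\<lambda>k. 1/3 * (h + 2 * sqrt (\<tau> h) * cos (1/3 * (pi / 2 + k * pi)))) {#0, 2, 4#}
      = {#1, -1/2, -2#}" if "h = -3/2"
  proof -
    have *: "arctan_ge h = pi / 2"
      using that by (simp add: arctan_ge_def)
    from that have "h \<ge> -3/2" by simp
    from ge[OF this, unfolded *, symmetric] mid[OF that] show ?thesis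
      by (rule trans)
  qed
  moreover have "image_mset (\<lambda>k. 1/3 * (h - 2 * sqrt (\<tau> h) * cos (1/3 * (- (pi / 2) + k * pi)))) {#0, 2, 4#}
      = {#1, -1/2, -2#}" if "h = -3/2"
  proof -
    have *: "arctan_le h = - (pi / 2)"
      using that by (simp add: arctan_le_def)
    from that have "h \<le> -3/2" by simp
    from le[OF this, unfolded *, symmetric] mid[OF that] show ?thesis
      by (rule trans)
  qed
  ultimately show ?thesis
    using ge le mid by blast
qed

end
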